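(* Let $(P,\preceq,\wedge,\vee,\hat 0)$ be a locally finite lattice with least element $\hat 0$, let $f:P\to\mathbb{C}$ be semimultiplicative with $f(x)\neq 0$ for all $x\in P$, and put $g(x)=1/f(x)$. Let $S=\{x_1,\ldots,x_n\}$ be a finite meet closed subset of $P$ such that $x_i\preceq x_j$ only if $i\leq j$, and suppose $\Delta_i(f)\neq 0$ for all $i$. Then every $\lambda\in\mathbb{C}$ for which there is $x\in\mathbb{C}^n\setminus\{0\}$ with $[S]_fx=\lambda(S)_fx$ satisfies \[ |\lambda|\leq\max_{1\le i\le n}|f(x_i)|^2\cdot M_g\,m_f^{-1}\,C_n\,c_n^{-1},\qquad M_g=\max_{1\le i\le n}|\Delta_i(g)|,\ m_f=\min_{1\le i\le n}|\Delta_i(f)|. \]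
   Context: Incidence functions of $P$ are functions $h:P\times P\to\mathbb{C}$ with $h(x,y)=0$ whenever $x\not\preceq y$; convolution $(h*k)(x,y)=\sum_{x\preceq z\preceq y}h(x,z)k(z,y)$. The Möbius function $\mu$: $\mu(x,x)=1$, $\mu(x,y)=-\sum_{x\preceq z\prec y}\mu(x,z)$ for $x\prec y$. For $h:P\to\mathbb{C}$, $h_d$ is an incidence function with $h_d(\hat 0,z)=h(z)$, so $(h_d*\mu)(\hat 0,z)=\sum_{w\preceq z}h(w)\mu(w,z)$. $\Delta_i(h)=\sum(h_d*\mu)(\hat 0,z)$ over all $z\in P$ with $z\preceq x_i$ and $z\not\preceq x_j$ for every $j<i$. Meet matrix $(S)_f$: $(i,j)$ entry $f(x_i\wedge x_j)$; join matrix $[S]_f$: $(i,j)$ entry $f(x_i\vee x_j)$. $S$ is meet closed if $x\wedge y\in S$ for all $x,y\in S$. $f$ is semimultiplicative if $f(x\wedge y)f(x\vee y)=f(x)f(y)$ for all $x,y$. $K(n)$ is the set of $n\times n$ lower triangular $0$-$1$ matrices with all diagonal entries $1$; $c_n=\min\{\lambda: X\in K(n),\ \lambda$ the smallest eigenvalue of $XX^{\mathrm T}\}$, $C_n=\max\{\lambda: X\in K(n),\ \lambda$ the largest eigenvalue of $XX^{\mathrm T}\}$. *)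

theory Defs
  imports Complex_Main "Jordan_Normal_Form.Spectral_Radius"
begin

class locally_finite_lattice = bounded_lattice_bot +
  assumes finite_interval: "finite {x..y}"

definition incidence :: "('p::order \<Rightarrow> 'p \<Rightarrow> complex) \<Rightarrow> bool" where
  "incidence h \<longleftrightarrow> (\<forall>x y. \<not> x \<le> y \<longrightarrow> h x y = 0)"

definition convolution ::
  "('p::order \<Rightarrow> 'p \<Rightarrow> complex) \<Rightarrow> ('p \<Rightarrow> 'p \<Rightarrow> complex) \<Rightarrow> 'p \<Rightarrow> 'p \<Rightarrow> complex" where
  "convolution h k x y = (\<Sum>z\<in>{x..y}. h x z * k z y)"

function mobius :: "'p::locally_finite_lattice \<Rightarrow> 'p \<Rightarrow> complex" where
  "mobius x y =
     (if x = y then 1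
      else if x < y then - (\<Sum>z\<in>{x..<y}. mobius x z)
      else 0)"
  by pat_completeness auto
termination
proof (relation "measure (\<lambda>(x, y). card {x..y})")
  fix x y z :: "'p::locally_finite_lattice"
  assume "x < y" and "z \<in> {x..<y}"
  then have "{x..z} \<subset> {x..y}"
    by auto
  then show "((x, z), (x, y)) \<in> measure (\<lambda>(x, y). card {x..y})"
    by (simp add: psubset_card_mono finite_interval)
qed simp

declare mobius.simps [simp del]

text \<open>
  Any incidence function whose row at \<^term>\<open>bot\<close> is \<open>h\<close> may serve as \<open>h\<^sub>d\<close>. Here the
  remaining rows are set to zero; by \<open>convolution_bot_row\<close> below, the choice
  does not affect the values used in \<open>Delta\<close>.
\<close>
definition lift_d :: "('p::order_bot \<Rightarrow> complex) \<Rightarrow> 'p \<Rightarrow> 'p \<Rightarrow> complex" where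
  "lift_d h x z = (if x = bot then h z else 0)"

lemma incidence_lift_d: "incidence (lift_d h)"
  by (simp add: incidence_def lift_d_def)

lemma incidence_mobius: "incidence mobius"
  by (auto simp: incidence_def mobius.simps)

lemma convolution_bot_row:
  fixes h :: "'p::order_bot \<Rightarrow> complex"
  assumes "\<And>z. hd' bot z = h z"
  shows "convolution hd' k bot z = convolution (lift_d h) k bot z"
    and "convolution hd' k bot z = (\<Sum>w\<in>{..z}. h w * k w z)"
proof -
  have "{bot..z} = {..z}" by auto
  then show "convolution hd' k bot z = convolution (lift_d h) k bot z"
    and "convolution hd' k bot z = (\<Sum>w\<in>{..z}. h w * k w z)"
    using assms by (simp_all add: convolution_def lift_d_def)
qed

text \<open>The elements of \<open>S\<close> are listed as \<open>x 0, \<dots>, x (n - 1)\<close>; all indices start at 0.\<close>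

definition Delta ::
  "(nat \<Rightarrow> 'p::locally_finite_lattice) \<Rightarrow> ('p \<Rightarrow> complex) \<Rightarrow> nat \<Rightarrow> complex" where
  "Delta x h i =
     (\<Sum>z | z \<le> x i \<and> (\<forall>j<i. \<not> z \<le> x j). convolution (lift_d h) mobius bot z)"

lemma finite_Delta_index:
  "finite {z. z \<le> x i \<and> (\<forall>j<i. \<not> z \<le> (x j :: 'p::locally_finite_lattice))}"
  by (rule finite_subset[OF _ finite_interval[of bot "x i"]]) auto

definition meet_matrix ::
  "nat \<Rightarrow> (nat \<Rightarrow> 'p::lattice) \<Rightarrow> ('p \<Rightarrow> complex) \<Rightarrow> complex mat" where
  "meet_matrix n x f = mat n n (\<lambda>(i, j). f (inf (x i) (x j)))"

definition join_matrix ::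
  "nat \<Rightarrow> (nat \<Rightarrow> 'p::lattice) \<Rightarrow> ('p \<Rightarrow> complex) \<Rightarrow> complex mat" where
  "join_matrix n x f = mat n n (\<lambda>(i, j). f (sup (x i) (x j)))"

definition meet_closed :: "'p::lattice set \<Rightarrow> bool" where
  "meet_closed S \<longleftrightarrow> (\<forall>x\<in>S. \<forall>y\<in>S. inf x y \<in> S)"

definition semimultiplicative :: "('p::lattice \<Rightarrow> complex) \<Rightarrow> bool" where
  "semimultiplicative f \<longleftrightarrow> (\<forall>x y. f (inf x y) * f (sup x y) = f x * f y)"

definition K :: "nat \<Rightarrow> real mat set" where
  "K n = {X \<in> carrier_mat n n.
     (\<forall>i<n. \<forall>j<n. X $$ (i, j) \<in> {0, 1}) \<and>
     (\<forall>i<n. \<forall>j<n. i < j \<longrightarrow> X $$ (i, j) = 0) \<and>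
     (\<forall>i<n. X $$ (i, i) = 1)}"

text \<open>
  \<^term>\<open>X * transpose_mat X\<close> is real symmetric, so its real spectrum is the set of all its
  eigenvalues, and it is finite and nonempty for \<open>n > 0\<close>.
\<close>
definition c_const :: "nat \<Rightarrow> real" where
  "c_const n = Min {Min (spectrum (X * transpose_mat X)) | X. X \<in> K n}"

definition C_const :: "nat \<Rightarrow> real" where
  "C_const n = Max {Max (spectrum (X * transpose_mat X)) | X. X \<in> K n}"

end

theory Submission
  imports Defs "HOL-Analysis.Function_Topology" "HOL-Analysis.Convex"
begin

text \<open>
  Let \<open>E\<close> be the \<open>0\<close>-\<open>1\<close> matrix with \<open>E\<^sub>i\<^sub>k = 1\<close> iff \<open>x k \<le> x i\<close>; it lies in \<open>K n\<close>. Since \<open>S\<close> is meet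
  closed, Moebius inversion gives \<open>(S)\<^sub>h = E diag(\<Delta>\<^sub>k(h)) E\<^sup>T\<close> for every \<open>h\<close>, and
  semimultiplicativity gives \<open>[S]\<^sub>f = D (S)\<^sub>g D\<close> with \<open>D = diag(f(x i))\<close>. The variational
  characterization of the extreme eigenvalues of \<open>E E\<^sup>T\<close> yields
  \<open>c\<^sub>n |z|\<^sup>2 \<le> |E\<^sup>T z|\<^sup>2 \<le> C\<^sub>n |z|\<^sup>2\<close>. With \<open>u = diag(\<Delta>\<^sub>k(f)) E\<^sup>T v\<close> and \<open>y\<close> such that \<open>E\<^sup>T y\<close> is
  the conjugate of \<open>u\<close>, multiplying \<open>[S]\<^sub>f v = \<lambda> (S)\<^sub>f v\<close> by \<open>y\<^sup>T\<close> and applying the Cauchy-Schwarz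
  inequality gives the bound.
\<close>

section \<open>Extreme eigenvalues of a real symmetric matrix as bounds for its quadratic
  form\<close>

text \<open>For small \<open>t\<close> the linear term dominates, so a nonzero \<open>b\<close>
  would produce a negative value. This is the first-order condition at a minimizer of a quadratic
  form.\<close>

lemma mult_linear_eq_zero_if_quadratic_nonneg:
  fixes b d :: real
  assumes "\<And>t. 0 \<le> 2 * t * b + t\<^sup>2 * d"
  shows "b = 0"
proof (rule ccontr)
  assume "b \<noteq> 0"
  \<comment> \<open>Positive and larger than \<open>d\<close>, so the choice
    \<open>t = - b / D\<close> gives the negative value
    \<open>(b / D)\<^sup>2 * (d - 2 * D)\<close>.\<close>
  define D where "D = \<bar>d\<bar> + 1"
  have D: "D > 0" "d < D" by (auto simp: D_def)
  have "0 \<le> 2 * (- b / D) * b + (- b / D)\<^sup>2 * d" by (rule assms)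
  also have "\<dots> = (b / D)\<^sup>2 * (d - 2 * D)"
    using D by (simp add: field_simps power2_eq_square)
  also have "\<dots> < 0"
    using D \<open>b \<noteq> 0\<close> by (intro mult_pos_neg) auto
  finally show False by simp
qed

text \<open>Vectors are functions on all naturals with the product topology. Pinning the coordinates
  from \<open>n\<close> on to 0 puts the sphere inside a product of compact sets, so Tychonoff's
  theorem applies.\<close>

lemma compact_coordinate_sphere:
  "compact {u :: nat \<Rightarrow> real. (\<forall>i\<ge>n. u i = 0) \<and> (\<Sum>i<n. (u i)\<^sup>2) = 1}"
proof -
  define B where "B = (\<lambda>i. if i < n then {-1..1} else {0::real})"
  have "compact (PiE UNIV B)"
    using compactin_PiE[of "\<lambda>_::nat. euclidean :: real topology" UNIV B]
    by (simp add: euclidean_product_topology B_def)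
  moreover have "closed {u :: nat \<Rightarrow> real. (\<Sum>i<n. (u i)\<^sup>2) = 1}"
    by (intro closed_Collect_eq continuous_intros continuous_on_product_coordinates)
  ultimately have "compact (PiE UNIV B \<inter> {u. (\<Sum>i<n. (u i)\<^sup>2) = 1})"
    by (rule compact_Int_closed)
  also have "PiE UNIV B \<inter> {u. (\<Sum>i<n. (u i)\<^sup>2) = 1} =
      {u. (\<forall>i\<ge>n. u i = 0) \<and> (\<Sum>i<n. (u i)\<^sup>2) = 1}"
  proof (intro equalityI subsetI)
    fix u assume u: "u \<in> PiE UNIV B \<inter> {u. (\<Sum>i<n. (u i)\<^sup>2) = 1}"
    then have "u i \<in> B i" for i by auto
    then have "u i = 0" if "n \<le> i" for i using that by (metis B_def not_le singletonD)
    then show "u \<in> {u. (\<forall>i\<ge>n. u i = 0) \<and> (\<Sum>i<n. (u i)\<^sup>2) = 1}" using u by simp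
  next
    fix u :: "nat \<Rightarrow> real"
    assume "u \<in> {u. (\<forall>i\<ge>n. u i = 0) \<and> (\<Sum>i<n. (u i)\<^sup>2) = 1}"
    then have u: "\<forall>i\<ge>n. u i = 0" "(\<Sum>i<n. (u i)\<^sup>2) = 1" by simp_all
    have "\<bar>u i\<bar> \<le> 1" if "i < n" for i
    proof -
      have "(u i)\<^sup>2 \<le> (\<Sum>i<n. (u i)\<^sup>2)"
        using that by (intro member_le_sum) auto
      then show ?thesis using u by (simp add: abs_square_le_1)
    qed
    then have "u i \<in> B i" for i using u by (auto simp: B_def abs_le_iff minus_le_iff)
    then show "u \<in> PiE UNIV B \<inter> {u. (\<Sum>i<n. (u i)\<^sup>2) = 1}" using u by auto
  qed
  finally show ?thesis .
qed

text \<open>The form attains its minimum on the compact unit sphere. The minimum value is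
  \<open>m\<close>, and stationarity of a minimizer \<open>u\<close> is the eigenvalue
  equation.\<close>

lemma symmetric_form_minimizer:
  fixes a :: "nat \<Rightarrow> nat \<Rightarrow> real"
  assumes n: "0 < n" and sym: "\<And>i j. i < n \<Longrightarrow> j < n \<Longrightarrow> a i j = a j i"
  obtains m u where "\<exists>i<n. u i \<noteq> 0"
    and "\<And>i. i < n \<Longrightarrow> (\<Sum>j<n. a i j * u j) = m * u i"
    and "\<And>w. m * (\<Sum>i<n. (w i)\<^sup>2) \<le> (\<Sum>i<n. \<Sum>j<n. a i j * w i * w j)"
proof -
  define Q where "Q = (\<lambda>w. \<Sum>i<n. \<Sum>j<n. a i j * w i * w j)"
  define N where "N = (\<lambda>w :: nat \<Rightarrow> real. \<Sum>i<n. (w i)\<^sup>2)"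
  define T where "T = {u :: nat \<Rightarrow> real. (\<forall>i\<ge>n. u i = 0) \<and> (\<Sum>i<n. (u i)\<^sup>2) = 1}"
  have "(\<lambda>i. if i = 0 then 1 else 0) \<in> T"
    using n by (auto simp: T_def if_distrib[of "\<lambda>x. x\<^sup>2"] cong: if_cong)
  then have "T \<noteq> {}" by blast
  moreover have "continuous_on T Q"
    unfolding Q_def
    by (intro continuous_intros continuous_on_subset[OF continuous_on_product_coordinates]) auto
  ultimately obtain u where u: "u \<in> T" and min: "\<And>w. w \<in> T \<Longrightarrow> Q u \<le> Q w"
    using continuous_attains_inf[of T Q] compact_coordinate_sphere[of n] by (auto simp: T_def)
  have Nu: "N u = 1" using u by (simp add: T_def N_def)
  \<comment> \<open>Both sides are homogeneous of degree 2, so a vector with \<open>N w > 0\<close>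
    can be normalized; if \<open>N w = 0\<close>, its first \<open>n\<close> coordinates
    vanish.\<close>
  have bound: "Q u * N w \<le> Q w" for w
  proof (cases "N w = 0")
    case True
    then have "w i = 0" if "i < n" for i
      using that by (auto simp: N_def sum_nonneg_eq_0_iff)
    then show ?thesis using True by (simp add: Q_def)
  next
    case False
    then have pos: "N w > 0" using sum_nonneg[of "{..<n}" "\<lambda>i. (w i)\<^sup>2"] by (simp add: N_def)
    define w' where "w' = (\<lambda>i. if i < n then w i / sqrt (N w) else 0)"
    have "N w' = (\<Sum>i<n. (w' i)\<^sup>2)" by (simp add: N_def)
    also have "\<dots> = (\<Sum>i<n. (w i)\<^sup>2 / N w)"
      unfolding w'_def using pos by (intro sum.cong) (auto simp: power_divide)
    also have "\<dots> = 1" using pos by (simp add: sum_divide_distrib[symmetric] N_def)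
    finally have "w' \<in> T" by (auto simp: T_def N_def w'_def)
    then have "Q u \<le> Q w'" by (rule min)
    also have "Q w' = (\<Sum>i<n. \<Sum>j<n. a i j * w i * w j / N w)"
      unfolding Q_def w'_def using pos by (intro sum.cong) auto
    also have "\<dots> = Q w / N w" by (simp add: Q_def sum_divide_distrib)
    finally show ?thesis using pos by (simp add: field_simps)
  qed
  have "(\<Sum>j<n. a i j * u j) = Q u * u i" if i: "i < n" for i
  proof -
    let ?b = "(\<Sum>j<n. a i j * u j) - Q u * u i" and ?d = "a i i - Q u"
    \<comment> \<open>\<open>Q - Q u * N\<close> is nonnegative by \<open>bound\<close> and vanishes
      at \<open>u\<close>. Moving coordinate \<open>i\<close> of \<open>u\<close> by
      \<open>t\<close> changes it by exactly this polynomial in \<open>t\<close>.\<close>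
    have "0 \<le> 2 * t * ?b + t\<^sup>2 * ?d" for t
    proof -
      define h where "h = (\<lambda>j. if j = i then t else 0)"
      have pick: "(\<Sum>j<n. c j * h j) = c i * t" for c
        using i by (subst sum.remove[of _ i]) (auto simp: h_def)
      have "Q (\<lambda>j. u j + h j) = Q u + (\<Sum>k<n. \<Sum>j<n. a k j * u k * h j)
         + (\<Sum>k<n. \<Sum>j<n. a k j * h k * u j) + (\<Sum>k<n. \<Sum>j<n. a k j * h k * h j)"
        by (simp only: Q_def sum.distrib[symmetric]) (simp add: algebra_simps)
      also have "(\<Sum>k<n. \<Sum>j<n. a k j * h k * u j) = (\<Sum>j<n. \<Sum>k<n. a k j * u j * h k)"
        by (subst sum.swap) (simp add: mult_ac)
      also have "\<dots> = t * (\<Sum>j<n. a i j * u j)"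
        by (simp only: pick) (simp add: sum_distrib_left mult_ac)
      also have "(\<Sum>k<n. \<Sum>j<n. a k j * u k * h j) = (\<Sum>k<n. a k i * u k * t)"
        by (simp only: pick)
      also have "\<dots> = t * (\<Sum>j<n. a i j * u j)"
        using i unfolding sum_distrib_left by (intro sum.cong refl) (simp add: sym)
      also have "(\<Sum>k<n. \<Sum>j<n. a k j * h k * h j) = (\<Sum>k<n. a k i * h k * t)"
        by (simp only: pick)
      also have "\<dots> = (\<Sum>k<n. (a k i * t) * h k)"
        by (simp add: mult_ac)
      also have "\<dots> = t\<^sup>2 * a i i"
        by (subst pick) (simp add: power2_eq_square)
      finally have 1: "Q (\<lambda>j. u j + h j) = Q u + 2 * t * (\<Sum>j<n. a i j * u j) + t\<^sup>2 * a i i"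
        by simp
      have "N (\<lambda>j. u j + h j) = N u + (\<Sum>k<n. (2 * u k) * h k) + (\<Sum>k<n. h k * h k)"
        by (simp only: N_def sum.distrib[symmetric]) (simp add: algebra_simps power2_eq_square)
      also have "\<dots> = 1 + 2 * u i * t + t\<^sup>2"
        unfolding pick by (simp add: Nu h_def power2_eq_square)
      finally have 2: "N (\<lambda>j. u j + h j) = 1 + 2 * u i * t + t\<^sup>2" .
      show ?thesis using bound[of "\<lambda>j. u j + h j"] unfolding 1 2 by (simp add: algebra_simps)
    qed
    then show ?thesis using mult_linear_eq_zero_if_quadratic_nonneg[of ?b ?d] by simp
  qed
  moreover have "\<exists>i<n. u i \<noteq> 0"
    using Nu by (force simp: N_def intro: ccontr)
  ultimately show ?thesis using that[of u "Q u"] bound by (simp add: Q_def N_def)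
qed

lemma mult_mat_vec_index:
  assumes "A \<in> carrier_mat m n" "w \<in> carrier_vec n" "i < m"
  shows "(A *\<^sub>v w) $ i = (\<Sum>j<n. A $$ (i, j) * w $ j)"
  using assms by (simp add: scalar_prod_def atLeast0LessThan)

lemma spectrumI_sum:
  fixes A :: "'a::field mat"
  assumes A: "A \<in> carrier_mat n n" and u: "\<exists>i<n. u i \<noteq> 0"
    and eq: "\<And>i. i < n \<Longrightarrow> (\<Sum>j<n. A $$ (i, j) * u j) = m * u i"
  shows "m \<in> spectrum A"
proof -
  have "vec n u \<noteq> 0\<^sub>v n" using u by (auto simp: vec_eq_iff)
  moreover have "A *\<^sub>v vec n u = m \<cdot>\<^sub>v vec n u"
    using A eq by (intro eq_vecI) (auto simp: mult_mat_vec_index simp del: index_mult_mat_vec)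
  ultimately have "eigenvector A (vec n u) m"
    using A by (auto simp: eigenvector_def)
  then show ?thesis by (auto simp: spectrum_def eigenvalue_def)
qed

lemma spectrumE_sum:
  fixes A :: "'a::field mat"
  assumes A: "A \<in> carrier_mat n n" and m: "m \<in> spectrum A"
  obtains u where "\<exists>i<n. u i \<noteq> 0"
    and "\<And>i. i < n \<Longrightarrow> (\<Sum>j<n. A $$ (i, j) * u j) = m * u i"
proof -
  obtain u where u: "u \<in> carrier_vec n" "u \<noteq> 0\<^sub>v n" "A *\<^sub>v u = m \<cdot>\<^sub>v u"
    using A m by (auto simp: spectrum_def eigenvalue_def eigenvector_def)
  have "\<exists>i<n. u $ i \<noteq> 0" using u by (auto simp: vec_eq_iff)
  moreover have "(\<Sum>j<n. A $$ (i, j) * u $ j) = m * u $ i" if "i < n" for i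
    using that u mult_mat_vec_index[OF A u(1) that] by simp
  ultimately show ?thesis using that[of "\<lambda>i. u $ i"] by blast
qed

text \<open>The minimum of the form on the unit sphere is an eigenvalue, hence at least the smallest
  one. The upper bound is the same argument for \<open>- A\<close>.\<close>

lemma symmetric_spectrum_bounds:
  fixes A :: "real mat"
  assumes A: "A \<in> carrier_mat n n" and n: "0 < n"
    and sym: "\<And>i j. i < n \<Longrightarrow> j < n \<Longrightarrow> A $$ (i, j) = A $$ (j, i)"
  shows "spectrum A \<noteq> {}"
    and "Min (spectrum A) * (\<Sum>i<n. (w i)\<^sup>2) \<le> (\<Sum>i<n. \<Sum>j<n. A $$ (i, j) * w i * w j)"
    and "(\<Sum>i<n. \<Sum>j<n. A $$ (i, j) * w i * w j) \<le> Max (spectrum A) * (\<Sum>i<n. (w i)\<^sup>2)"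
proof -
  have fin: "finite (spectrum A)" using A by (rule card_finite_spectrum)
  have nonneg: "0 \<le> (\<Sum>i<n. (w i)\<^sup>2)" by (simp add: sum_nonneg)
  obtain m u where u: "\<exists>i<n. u i \<noteq> 0" "\<And>i. i < n \<Longrightarrow> (\<Sum>j<n. A $$ (i, j) * u j) = m * u i"
    and le: "\<And>w. m * (\<Sum>i<n. (w i)\<^sup>2) \<le> (\<Sum>i<n. \<Sum>j<n. A $$ (i, j) * w i * w j)"
    by (rule symmetric_form_minimizer[of n "\<lambda>i j. A $$ (i, j)"])
      (use n sym in \<open>auto simp del: sum_negf\<close>)
  have m: "m \<in> spectrum A" using A u by (rule spectrumI_sum)
  then show "spectrum A \<noteq> {}" by blast
  show "Min (spectrum A) * (\<Sum>i<n. (w i)\<^sup>2) \<le> (\<Sum>i<n. \<Sum>j<n. A $$ (i, j) * w i * w j)"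
    using mult_right_mono[OF Min_le[OF fin m] nonneg] le[of w] by linarith
  \<comment> \<open>Now \<open>m\<close> belongs to the negated form, so the eigenvalue of
    \<open>A\<close> is \<open>- m\<close>.\<close>
  obtain m u where u: "\<exists>i<n. u i \<noteq> 0" "\<And>i. i < n \<Longrightarrow> (\<Sum>j<n. - A $$ (i, j) * u j) = m * u i"
    and le: "\<And>w. m * (\<Sum>i<n. (w i)\<^sup>2) \<le> (\<Sum>i<n. \<Sum>j<n. - A $$ (i, j) * w i * w j)"
    by (rule symmetric_form_minimizer[of n "\<lambda>i j. - A $$ (i, j)"])
      (use n sym in \<open>auto simp del: sum_negf\<close>)
  have "- m \<in> spectrum A" using A u(1)
  proof (rule spectrumI_sum)
    show "(\<Sum>j<n. A $$ (i, j) * u j) = - m * u i" if "i < n" for i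
      using u(2)[OF that] by (simp add: sum_negf)
  qed
  from mult_right_mono[OF Max_ge[OF fin this] nonneg] le[of w]
  show "(\<Sum>i<n. \<Sum>j<n. A $$ (i, j) * w i * w j) \<le> Max (spectrum A) * (\<Sum>i<n. (w i)\<^sup>2)"
    by (simp add: sum_negf)
qed

section \<open>Gram matrices of elements of \<open>K n\<close> and the constants
  \<open>c_const\<close> and \<open>C_const\<close>\<close>

lemma times_transpose_index:
  assumes "X \<in> carrier_mat n n" "i < n" "j < n"
  shows "(X * transpose_mat X) $$ (i, j) = (\<Sum>k<n. X $$ (i, k) * X $$ (j, k))"
  using assms by (simp add: scalar_prod_def atLeast0LessThan)

text \<open>Turns eigenvalue bounds for \<open>X * transpose_mat X\<close> into norm bounds for the
  transpose of \<open>X\<close> applied to \<open>w\<close>.\<close>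

lemma gram_form:
  fixes X :: "real mat"
  assumes "X \<in> carrier_mat n n"
  shows "(\<Sum>i<n. \<Sum>j<n. (X * transpose_mat X) $$ (i, j) * w i * w j)
    = (\<Sum>k<n. (\<Sum>i<n. X $$ (i, k) * w i)\<^sup>2)"
proof -
  have "(\<Sum>i<n. \<Sum>j<n. (X * transpose_mat X) $$ (i, j) * w i * w j)
      = (\<Sum>i<n. \<Sum>j<n. \<Sum>k<n. X $$ (i, k) * w i * (X $$ (j, k) * w j))"
    using assms by (simp add: times_transpose_index sum_distrib_right del: index_mult_mat) (simp add: mult_ac)
  also have "\<dots> = (\<Sum>i<n. \<Sum>k<n. \<Sum>j<n. X $$ (i, k) * w i * (X $$ (j, k) * w j))"
    by (intro sum.cong refl sum.swap)
  also have "\<dots> = (\<Sum>k<n. \<Sum>i<n. \<Sum>j<n. X $$ (i, k) * w i * (X $$ (j, k) * w j))"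
    by (rule sum.swap)
  also have "\<dots> = (\<Sum>k<n. (\<Sum>i<n. X $$ (i, k) * w i)\<^sup>2)"
    by (simp add: power2_eq_square sum_product)
  finally show ?thesis .
qed

text \<open>A triangular matrix with unit diagonal has determinant 1.\<close>

lemma K_inverse:
  assumes X: "X \<in> K n"
  obtains Y where "Y \<in> carrier_mat n n" "X * Y = 1\<^sub>m n" "Y * X = 1\<^sub>m n"
proof -
  have c: "X \<in> carrier_mat n n" using X by (simp add: K_def)
  have "det X = prod_list (diag_mat X)"
    using X by (intro det_lower_triangular[of n]) (auto simp: K_def)
  also have "\<dots> = 1"
    using X by (auto simp: K_def prod_list_diag_prod intro!: prod.neutral)
  finally have "det X \<noteq> 0" by simp
  from det_non_zero_imp_unit[OF c this, of "()"] show ?thesis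
    using that by (auto simp: Units_def ring_mat_def)
qed

text \<open>A 0-1 matrix is determined by the positions of its ones. Finiteness ensures that the
  \<open>Min\<close> and \<open>Max\<close> over \<open>K n\<close> are attained.\<close>

lemma finite_K: "finite (K n)"
proof (rule finite_subset)
  show "K n \<subseteq> (\<lambda>s. mat n n (\<lambda>p. if p \<in> s then 1 else 0)) ` Pow ({..<n} \<times> {..<n})"
  proof
    fix X assume X: "X \<in> K n"
    let ?s = "{p \<in> {..<n} \<times> {..<n}. X $$ p = 1}"
    have "X = mat n n (\<lambda>p. if p \<in> ?s then 1 else 0)"
      using X by (intro eq_matI) (auto simp: K_def)
    then show "X \<in> (\<lambda>s. mat n n (\<lambda>p. if p \<in> s then 1 else 0)) ` Pow ({..<n} \<times> {..<n})"
      by blast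
  qed
qed simp

text \<open>For an eigenvector \<open>u\<close>, the squared norm of the transpose of
  \<open>X\<close> applied to \<open>u\<close> is \<open>m\<close> times that of \<open>u\<close>,
  and it is nonzero because \<open>X\<close> is invertible.\<close>

lemma K_gram_spectrum_pos:
  assumes X: "X \<in> K n" and m: "m \<in> spectrum (X * transpose_mat X)"
  shows "0 < m"
proof -
  have c: "X \<in> carrier_mat n n" "X * transpose_mat X \<in> carrier_mat n n"
    using X by (auto simp: K_def)
  obtain u where u: "\<exists>i<n. u i \<noteq> 0"
    and eq: "\<And>i. i < n \<Longrightarrow> (\<Sum>j<n. (X * transpose_mat X) $$ (i, j) * u j) = m * u i"
    using spectrumE_sum[OF c(2) m] by blast
  obtain Y where Y: "Y \<in> carrier_mat n n" "X * Y = 1\<^sub>m n" using K_inverse[OF X] by blast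
  define t where "t = (\<lambda>k. \<Sum>i<n. X $$ (i, k) * u i)"
  have "(\<Sum>k<n. (t k)\<^sup>2) = (\<Sum>i<n. u i * (\<Sum>j<n. (X * transpose_mat X) $$ (i, j) * u j))"
    unfolding t_def gram_form[OF c(1), symmetric] by (simp add: sum_distrib_left mult_ac)
  also have "\<dots> = (\<Sum>i<n. u i * (m * u i))"
    by (intro sum.cong refl) (simp only: eq lessThan_iff)
  also have "\<dots> = m * (\<Sum>i<n. (u i)\<^sup>2)"
    by (simp add: sum_distrib_left power2_eq_square mult_ac)
  finally have *: "(\<Sum>k<n. (t k)\<^sup>2) = m * (\<Sum>i<n. (u i)\<^sup>2)" .
  have "\<exists>k<n. t k \<noteq> 0"
  proof (rule ccontr)
    assume "\<not> (\<exists>k<n. t k \<noteq> 0)"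
    then have "(\<Sum>k<n. t k * Y $$ (k, j)) = 0" for j by simp
    \<comment> \<open>The right inverse \<open>Y\<close> of \<open>X\<close> recovers
      \<open>u\<close> from \<open>t\<close>, so \<open>t = 0\<close> would force
      \<open>u = 0\<close>.\<close>
    moreover have "(\<Sum>k<n. t k * Y $$ (k, j)) = u j" if j: "j < n" for j
    proof -
      have "(\<Sum>k<n. t k * Y $$ (k, j)) = (\<Sum>i<n. (\<Sum>k<n. X $$ (i, k) * Y $$ (k, j)) * u i)"
        unfolding t_def sum_distrib_right by (subst sum.swap) (simp add: mult_ac)
      also have "\<dots> = (\<Sum>i<n. (X * Y) $$ (i, j) * u i)"
        using c Y(1) j by (simp add: scalar_prod_def atLeast0LessThan)
      also have "\<dots> = u j" using j by (subst sum.remove[of _ j]) (auto simp: Y(2))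
      finally show ?thesis .
    qed
    ultimately show False using u by auto
  qed
  then have "0 < (\<Sum>k<n. (t k)\<^sup>2)"
    by (auto intro!: sum_pos2)
  then have "0 < m * (\<Sum>i<n. (u i)\<^sup>2)" using * by simp
  then show ?thesis using sum_nonneg[of "{..<n}" "\<lambda>i. (u i)\<^sup>2"] by (simp add: zero_less_mult_iff)
qed

lemma one_mat_in_K: "1\<^sub>m n \<in> K n"
  by (auto simp: K_def)

lemma gram_sym:
  assumes "X \<in> carrier_mat n n" "i < n" "j < n"
  shows "(X * transpose_mat X) $$ (i, j) = ((X * transpose_mat X) $$ (j, i) :: real)"
  using assms by (simp add: times_transpose_index mult_ac del: index_mult_mat)

text \<open>Both minima are over finite nonempty sets, so \<open>c_const n\<close> is itself an
  eigenvalue of some Gram matrix.\<close>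

lemma c_const_pos:
  assumes "0 < n"
  shows "0 < c_const n"
proof -
  have "c_const n \<in> {Min (spectrum (X * transpose_mat X)) | X. X \<in> K n}"
    unfolding c_const_def using finite_K[of n] one_mat_in_K[of n] by (intro Min_in) auto
  then obtain X where X: "X \<in> K n" and c: "c_const n = Min (spectrum (X * transpose_mat X))"
    by blast
  have A: "X \<in> carrier_mat n n" "X * transpose_mat X \<in> carrier_mat n n"
    using X by (auto simp: K_def)
  have "c_const n \<in> spectrum (X * transpose_mat X)"
    unfolding c
    using card_finite_spectrum(1)[OF A(2)] symmetric_spectrum_bounds(1)[OF A(2) assms gram_sym[OF A(1)]]
    by (intro Min_in) auto
  with X show ?thesis by (rule K_gram_spectrum_pos)
qed

lemma K_form_bounds_real:
  assumes X: "X \<in> K n" and n: "0 < n"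
  shows "c_const n * (\<Sum>i<n. (w i)\<^sup>2) \<le> (\<Sum>k<n. (\<Sum>i<n. X $$ (i, k) * w i)\<^sup>2)"
    and "(\<Sum>k<n. (\<Sum>i<n. X $$ (i, k) * w i)\<^sup>2) \<le> C_const n * (\<Sum>i<n. (w i)\<^sup>2)"
proof -
  let ?A = "X * transpose_mat X"
  have A: "X \<in> carrier_mat n n" "?A \<in> carrier_mat n n"
    using X by (auto simp: K_def)
  have nonneg: "0 \<le> (\<Sum>i<n. (w i)\<^sup>2)" by (simp add: sum_nonneg)
  note bounds = symmetric_spectrum_bounds(2,3)[OF A(2) n gram_sym[OF A(1)], unfolded gram_form[OF A(1)], of w]
  have "c_const n \<le> Min (spectrum ?A)"
    unfolding c_const_def using finite_K[of n] X by (intro Min_le) auto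
  from mult_right_mono[OF this nonneg] bounds(1)
  show "c_const n * (\<Sum>i<n. (w i)\<^sup>2) \<le> (\<Sum>k<n. (\<Sum>i<n. X $$ (i, k) * w i)\<^sup>2)"
    by linarith
  have "Max (spectrum ?A) \<le> C_const n"
    unfolding C_const_def using finite_K[of n] X by (intro Max_ge) auto
  from mult_right_mono[OF this nonneg] bounds(2)
  show "(\<Sum>k<n. (\<Sum>i<n. X $$ (i, k) * w i)\<^sup>2) \<le> C_const n * (\<Sum>i<n. (w i)\<^sup>2)"
    by linarith
qed

text \<open>Since \<open>X\<close> is real, the real and imaginary parts of \<open>z\<close>
  separate, and the two real estimates add up.\<close>

lemma K_form_bounds:
  fixes z :: "nat \<Rightarrow> complex"
  assumes X: "X \<in> K n" and n: "0 < n"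
  shows "c_const n * (\<Sum>i<n. (cmod (z i))\<^sup>2) \<le> (\<Sum>k<n. (cmod (\<Sum>i<n. X $$ (i, k) * z i))\<^sup>2)"
    and "(\<Sum>k<n. (cmod (\<Sum>i<n. X $$ (i, k) * z i))\<^sup>2) \<le> C_const n * (\<Sum>i<n. (cmod (z i))\<^sup>2)"
  using K_form_bounds_real[OF X n, of "\<lambda>i. Re (z i)"] K_form_bounds_real[OF X n, of "\<lambda>i. Im (z i)"]
  by (simp_all add: cmod_power2 sum.distrib distrib_left)

text \<open>The solution is the transposed inverse of \<open>X\<close> applied to
  \<open>u\<close>.\<close>

lemma K_transpose_surj:
  fixes u :: "nat \<Rightarrow> complex"
  assumes X: "X \<in> K n"
  obtains y :: "nat \<Rightarrow> complex"
    where "\<And>k. k < n \<Longrightarrow> (\<Sum>i<n. X $$ (i, k) * y i) = u k"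
proof -
  have c: "X \<in> carrier_mat n n" using X by (auto simp: K_def)
  obtain Y where Y: "Y \<in> carrier_mat n n" "Y * X = 1\<^sub>m n" using K_inverse[OF X] by blast
  have "(\<Sum>i<n. X $$ (i, k) * (\<Sum>l<n. Y $$ (l, i) * u l)) = u k" if k: "k < n" for k
  proof -
    have "(\<Sum>i<n. X $$ (i, k) * (\<Sum>l<n. Y $$ (l, i) * u l))
        = (\<Sum>l<n. of_real (\<Sum>i<n. Y $$ (l, i) * X $$ (i, k)) * u l)"
      unfolding sum_distrib_left sum_distrib_right of_real_sum by (subst sum.swap) (simp add: mult_ac)
    also have "\<dots> = (\<Sum>l<n. of_real ((Y * X) $$ (l, k)) * u l)"
      using c Y(1) k by (simp add: scalar_prod_def atLeast0LessThan)
    also have "\<dots> = u k"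
      using k by (subst sum.remove[of _ k]) (auto simp: Y(2))
    finally show ?thesis .
  qed
  then show ?thesis by (rule that)
qed

section \<open>Moebius inversion and the factorization of meet matrices\<close>

text \<open>The recursion defines \<open>mobius w y\<close> so as to cancel the earlier terms; in
  convolution form, the Moebius function times zeta is the identity.\<close>

lemma mobius_sum:
  fixes w y :: "'p::locally_finite_lattice"
  assumes "w \<le> y"
  shows "(\<Sum>z\<in>{w..y}. mobius w z) = (if w = y then 1 else 0)"
proof (cases "w = y")
  case True
  then show ?thesis by (simp add: mobius.simps)
next
  case False
  with assms have "w < y" by simp
  then have "{w..y} = insert y {w..<y}" by auto
  moreover have "finite {w..<y}" by (rule finite_subset[OF _ finite_interval[of w y]]) auto
  ultimately have "(\<Sum>z\<in>{w..y}. mobius w z) = mobius w y + (\<Sum>z\<in>{w..<y}. mobius w z)" by simp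
  also have "mobius w y = - (\<Sum>z\<in>{w..<y}. mobius w z)"
    using \<open>w < y\<close> by (subst mobius.simps) auto
  finally show ?thesis using False by simp
qed

text \<open>Exchanging the two finite sums leaves sums of \<open>mobius w\<close> over
  \<open>{w..y}\<close>, of which only the one with \<open>w = y\<close> survives.\<close>

lemma mobius_inversion:
  fixes h :: "'p::locally_finite_lattice \<Rightarrow> complex"
  shows "(\<Sum>z\<in>{..y}. convolution (lift_d h) mobius bot z) = h y"
proof -
  have fin: "finite {..u}" for u :: 'p
    by (rule finite_subset[OF _ finite_interval[of bot u]]) auto
  have "(\<Sum>z\<in>{..y}. convolution (lift_d h) mobius bot z) = (\<Sum>z\<in>{..y}. \<Sum>w\<in>{..z}. h w * mobius w z)"
    by (intro sum.cong refl convolution_bot_row(2)) (simp add: lift_d_def)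
  also have "\<dots> = (\<Sum>z\<in>{..y}. \<Sum>w | w \<in> {..y} \<and> w \<le> z. h w * mobius w z)"
    by (intro sum.cong refl) auto
  also have "\<dots> = (\<Sum>w\<in>{..y}. \<Sum>z | z \<in> {..y} \<and> w \<le> z. h w * mobius w z)"
    by (rule sum.swap_restrict[OF fin fin])
  also have "\<dots> = (\<Sum>w\<in>{..y}. h w * (\<Sum>z\<in>{w..y}. mobius w z))"
    unfolding sum_distrib_left by (intro sum.cong refl) auto
  also have "\<dots> = (\<Sum>w\<in>{..y}. if w = y then h w else 0)"
    by (intro sum.cong refl) (auto simp: mobius_sum)
  also have "\<dots> = h y" using fin by simp
  finally show ?thesis .
qed

text \<open>The index sets of the \<open>Delta x h k\<close> with \<open>x k\<close> below the meet
  partition the down-set of the meet, over which Moebius inversion sums to \<open>h\<close>.\<close>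

lemma meet_closed_factorization:
  fixes h :: "'p::locally_finite_lattice \<Rightarrow> complex"
  assumes closed: "meet_closed (x ` {..<n})"
    and ordered: "\<And>i j. i < n \<Longrightarrow> j < n \<Longrightarrow> x i \<le> x j \<Longrightarrow> i \<le> j"
    and i: "i < n" and j: "j < n"
  shows "h (inf (x i) (x j)) =
    (\<Sum>k<n. (if x k \<le> x i then 1 else 0) * (if x k \<le> x j then 1 else 0) * Delta x h k)"
proof -
  define Z where "Z k = {z. z \<le> x k \<and> (\<forall>j<k. \<not> z \<le> x j)}" for k
  let ?F = "\<lambda>z. convolution (lift_d h) mobius bot z"
  let ?y = "inf (x i) (x j)"
  have meet: "\<exists>m<n. x m = inf (x k) (x l)" if "k < n" "l < n" for k l
    using closed that unfolding meet_closed_def by (metis (full_types) image_iff lessThan_iff)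
  obtain m where m: "m < n" "x m = ?y" using meet i j by blast
  have disj: "Z k \<inter> Z l = {}" if "k \<noteq> l" for k l
    using that by (cases k l rule: linorder_cases) (auto simp: Z_def)
  \<comment> \<open>Let \<open>k\<close> be the first index with \<open>z\<close> below
    \<open>x k\<close>. The meet of \<open>x k\<close> and \<open>x m\<close> is some
    \<open>x l\<close> above \<open>z\<close>, and \<open>l \<le> k\<close> by the ordering;
    minimality gives \<open>l = k\<close>, so \<open>x k\<close> lies below
    \<open>x m\<close>.\<close>
  have Un: "{..?y} = (\<Union>k\<in>{k. k < n \<and> x k \<le> ?y}. Z k)"
  proof (intro equalityI subsetI)
    fix z assume "z \<in> {..?y}"
    then have z: "z \<le> x m" using m by simp
    define k where "k = (LEAST k. z \<le> x k)"
    have k: "z \<le> x k" "k \<le> m" "\<forall>j<k. \<not> z \<le> x j"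
      unfolding k_def using z by (auto intro: LeastI Least_le dest: not_less_Least)
    obtain l where l: "l < n" "x l = inf (x k) (x m)" using meet[of k m] k m by auto
    have "l \<le> k" using ordered[of l k] l k m by simp
    moreover have "z \<le> x l" using l k z by simp
    ultimately have "l = k" using k by (meson le_neq_implies_less)
    then have "x k \<le> ?y" using l m by (metis inf.cobounded2)
    moreover have "k < n" "z \<in> Z k" using k m by (auto simp: Z_def)
    ultimately show "z \<in> (\<Union>k\<in>{k. k < n \<and> x k \<le> ?y}. Z k)" by blast
  next
    fix z assume "z \<in> (\<Union>k\<in>{k. k < n \<and> x k \<le> ?y}. Z k)"
    then show "z \<in> {..?y}" unfolding Z_def by (auto intro: order_trans)
  qed
  have "h ?y = (\<Sum>z\<in>{..?y}. ?F z)" by (simp add: mobius_inversion)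
  also have "\<dots> = (\<Sum>k | k < n \<and> x k \<le> ?y. \<Sum>z\<in>Z k. ?F z)"
    unfolding Un using disj finite_Delta_index[of x]
    by (intro sum.UNION_disjoint) (auto simp: Z_def)
  also have "\<dots> = (\<Sum>k | k \<in> {..<n} \<and> x k \<le> ?y. Delta x h k)"
    by (simp add: Delta_def Z_def)
  also have "\<dots> = (\<Sum>k<n. if x k \<le> ?y then Delta x h k else 0)"
    by (rule sum.inter_filter) simp
  \<comment> \<open>Lying below the meet means lying below both elements, so the indicator splits
    into a product.\<close>
  also have "\<dots> = (\<Sum>k<n. (if x k \<le> x i then 1 else 0) * (if x k \<le> x j then 1 else 0) * Delta x h k)"
    by (intro sum.cong refl) auto
  finally show ?thesis .
qed

section \<open>The eigenvalue bound for a pair of matrices factored through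
  \<open>K n\<close>\<close>

text \<open>The lattice-free core: \<open>d\<close>, \<open>a\<close> and \<open>b\<close> are the
  diagonals standing for \<open>f (x i)\<close>, \<open>Delta x g\<close> and
  \<open>Delta x f\<close>.\<close>

lemma K_congruence_pencil_bound:
  fixes a b d v :: "nat \<Rightarrow> complex" and lam :: complex
  assumes X: "X \<in> K n" and v: "\<exists>i<n. v i \<noteq> 0"
    and b_lower: "\<And>k. k < n \<Longrightarrow> \<beta> \<le> cmod (b k)" and \<beta>: "0 < \<beta>"
    and a_upper: "\<And>k. k < n \<Longrightarrow> cmod (a k) \<le> \<alpha>"
    and d_upper: "\<And>i. i < n \<Longrightarrow> (cmod (d i))\<^sup>2 \<le> \<delta>"
    and eigen: "\<And>i. i < n \<Longrightarrow>
      d i * (\<Sum>k<n. X $$ (i, k) * (a k * (\<Sum>j<n. X $$ (j, k) * (d j * v j))))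
      = lam * (\<Sum>k<n. X $$ (i, k) * (b k * (\<Sum>j<n. X $$ (j, k) * v j)))"
  shows "cmod lam \<le> \<delta> * \<alpha> * inverse \<beta> * C_const n * inverse (c_const n)"
proof -
  have n: "0 < n" using v by auto
  let ?E = "\<lambda>z k. \<Sum>i<n. of_real (X $$ (i, k)) * z i :: complex"
  let ?N = "\<lambda>z. \<Sum>i<n. (cmod (z i))\<^sup>2"
  let ?c = "c_const n" and ?C = "C_const n"
  have c: "0 < ?c" using n by (rule c_const_pos)
  have lower: "?c * ?N z \<le> ?N (?E z)" and upper: "?N (?E z) \<le> ?C * ?N z" for z
    using K_form_bounds[OF X n, of z] by simp_all
  have vpos: "0 < ?N v" using v by (auto intro!: sum_pos2)
  \<comment> \<open>At the nonzero \<open>v\<close>, the lower and upper bounds enclose the same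
    quantity, which is positive.\<close>
  have C: "0 \<le> ?C"
    using lower[of v] upper[of v] mult_pos_pos[OF c vpos] vpos by (smt (verit) mult_nonpos_nonneg mult_neg_pos)
  have \<alpha>: "0 \<le> \<alpha>" using a_upper[OF n] norm_ge_zero order_trans by blast
  have \<delta>: "0 \<le> \<delta>" using d_upper[OF n] zero_le_power2 order_trans by blast
  define u where "u = (\<lambda>k. b k * ?E v k)"
  obtain y where y: "\<And>k. k < n \<Longrightarrow> ?E y k = cnj (u k)"
    using K_transpose_surj[OF X, of "\<lambda>k. cnj (u k)"] by blast
  define p where "p = ?E (\<lambda>i. d i * v i)"
  define q where "q = ?E (\<lambda>i. d i * y i)"
  have dbound: "?N (\<lambda>i. d i * z i) \<le> \<delta> * ?N z" for z
    unfolding sum_distrib_left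
    by (intro sum_mono) (auto simp: norm_mult power_mult_distrib intro!: mult_right_mono d_upper)
  \<comment> \<open>Conjugation preserves the modulus, so \<open>?N (?E y)\<close> equals
    \<open>?N u\<close>.\<close>
  have Ny: "?c * ?N y \<le> ?N u" using lower[of y] y by simp
  have Nu: "\<beta>\<^sup>2 * (?c * ?N v) \<le> ?N u"
  proof -
    have "\<beta>\<^sup>2 * (?c * ?N v) \<le> \<beta>\<^sup>2 * ?N (?E v)" using lower by (intro mult_left_mono) auto
    also have "\<dots> \<le> ?N u"
      unfolding sum_distrib_left
    proof (rule sum_mono)
      fix k assume "k \<in> {..<n}"
      then have "\<beta>\<^sup>2 \<le> (cmod (b k))\<^sup>2" using b_lower \<beta> by (intro power_mono) auto
      then show "\<beta>\<^sup>2 * (cmod (?E v k))\<^sup>2 \<le> (cmod (u k))\<^sup>2"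
        unfolding u_def norm_mult power_mult_distrib by (rule mult_right_mono) simp
    qed
    finally show ?thesis .
  qed
  have upos: "0 < ?N u" using Nu c \<beta> vpos by (meson mult_pos_pos order_less_le_trans zero_less_power)
  have Np: "?N p \<le> ?C * \<delta> * ?N v" and Nq: "?N q \<le> ?C * \<delta> * ?N y"
    using upper[of "\<lambda>i. d i * v i"] upper[of "\<lambda>i. d i * y i"]
      mult_left_mono[OF dbound C, of v] mult_left_mono[OF dbound C, of y]
    by (simp_all add: p_def q_def mult_ac)
  have swap: "(\<Sum>i<n. z i * (\<Sum>k<n. X $$ (i, k) * t k)) = (\<Sum>k<n. ?E z k * t k)" for z t :: "nat \<Rightarrow> complex"
    unfolding sum_distrib_left sum_distrib_right by (subst sum.swap) (simp add: mult_ac)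
  have "(\<Sum>k<n. q k * (a k * p k)) = (\<Sum>i<n. y i * (d i * (\<Sum>k<n. X $$ (i, k) * (a k * p k))))"
    unfolding q_def swap[symmetric] by (simp add: mult_ac)
  also have "\<dots> = (\<Sum>i<n. y i * (lam * (\<Sum>k<n. X $$ (i, k) * u k)))"
    using eigen by (simp add: p_def u_def)
  also have "\<dots> = lam * (\<Sum>i<n. y i * (\<Sum>k<n. X $$ (i, k) * u k))"
    by (simp add: sum_distrib_left mult_ac)
  also have "\<dots> = lam * (\<Sum>k<n. cnj (u k) * u k)"
    unfolding swap using y by simp
  also have "(\<Sum>k<n. cnj (u k) * u k) = of_real (?N u)"
    unfolding of_real_sum complex_norm_square by (simp add: mult.commute)
  finally have "cmod lam * ?N u = cmod (\<Sum>k<n. q k * (a k * p k))"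
    using upos by (simp only: norm_mult norm_of_real)
  also have "\<dots> \<le> (\<Sum>k<n. \<alpha> * (cmod (p k) * cmod (q k)))"
    using a_upper \<alpha> by (intro sum_norm_le) (auto simp: norm_mult mult_ac intro!: mult_left_mono mult_right_mono)
  also have "\<dots> = \<alpha> * (\<Sum>k<n. cmod (p k) * cmod (q k))"
    by (simp add: sum_distrib_left)
  also have "\<dots> \<le> \<alpha> * (?C * \<delta> / (\<beta> * ?c) * ?N u)"
  \<comment> \<open>Squares are compared: \<open>Nu\<close> and \<open>Ny\<close> each contribute
    one factor \<open>?c\<close>, so a single \<open>?c\<close> remains after taking the
    root.\<close>
  proof (rule mult_left_mono[OF _ \<alpha>], rule power2_le_imp_le)
    have "(\<Sum>k<n. cmod (p k) * cmod (q k))\<^sup>2 \<le> ?N p * ?N q"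
      by (rule Cauchy_Schwarz_ineq_sum)
    also have "\<dots> \<le> (?C * \<delta> * ?N v) * (?C * \<delta> * ?N y)"
      using Np Nq C \<delta> by (intro mult_mono) (auto intro!: mult_nonneg_nonneg sum_nonneg)
    also have "\<dots> = (?C * \<delta>)\<^sup>2 * (?N v * ?N y)" by (simp add: power2_eq_square)
    also have "\<dots> \<le> (?C * \<delta>)\<^sup>2 * (?N u / (\<beta>\<^sup>2 * ?c) * (?N u / ?c))"
      using Nu Ny c \<beta> upos
      by (intro mult_left_mono mult_mono) (auto simp: field_simps intro!: sum_nonneg)
    also have "\<dots> = (?C * \<delta> / (\<beta> * ?c) * ?N u)\<^sup>2"
      by (simp add: power2_eq_square mult_ac)
    finally show "(\<Sum>k<n. cmod (p k) * cmod (q k))\<^sup>2 \<le> (?C * \<delta> / (\<beta> * ?c) * ?N u)\<^sup>2" .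
    show "0 \<le> ?C * \<delta> / (\<beta> * ?c) * ?N u"
      using C \<delta> \<beta> c upos by simp
  qed
  also have "\<dots> = (\<delta> * \<alpha> * inverse \<beta> * ?C * inverse ?c) * ?N u"
    by (simp add: divide_inverse)
  finally show ?thesis using upos by simp
qed

section \<open>Application to the meet and join matrices\<close>

lemma incidence_mat_in_K:
  fixes x :: "nat \<Rightarrow> 'p::order"
  assumes "\<And>i j. i < n \<Longrightarrow> j < n \<Longrightarrow> x i \<le> x j \<Longrightarrow> i \<le> j"
  shows "mat n n (\<lambda>(i, k). if x k \<le> x i then 1 else 0) \<in> K n"
  using assms by (force simp: K_def)

theorem theorem3:
  fixes f g :: "'p::locally_finite_lattice \<Rightarrow> complex"
    and x :: "nat \<Rightarrow> 'p" and S :: "'p set" and n :: nat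
    and v :: "complex vec" and lam :: complex
  assumes f_semi: "semimultiplicative f"
    and f_nz: "\<And>y. f y \<noteq> 0"
    and g_def: "\<And>y. g y = 1 / f y"
    and S_def: "S = x ` {..<n}"
    and S_meet: "meet_closed S"
    and ordered: "\<And>i j. i < n \<Longrightarrow> j < n \<Longrightarrow> x i \<le> x j \<Longrightarrow> i \<le> j"
    and Delta_nz: "\<And>i. i < n \<Longrightarrow> Delta x f i \<noteq> 0"
    and v: "v \<in> carrier_vec n" "v \<noteq> 0\<^sub>v n"
    and eigen: "join_matrix n x f *\<^sub>v v = lam \<cdot>\<^sub>v (meet_matrix n x f *\<^sub>v v)"
  shows "cmod lam \<le>
    (MAX i\<in>{..<n}. (cmod (f (x i)))\<^sup>2)
      * (MAX i\<in>{..<n}. cmod (Delta x g i))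
      * inverse (MIN i\<in>{..<n}. cmod (Delta x f i))
      * C_const n * inverse (c_const n)"
proof -
  define X :: "real mat" where "X = mat n n (\<lambda>(i, k). if x k \<le> x i then 1 else 0)"
  have X: "X \<in> K n" unfolding X_def using ordered by (rule incidence_mat_in_K)
  have vnz: "\<exists>i<n. v $ i \<noteq> 0" using v by (auto simp: vec_eq_iff)
  have meet: "h (inf (x i) (x j)) = (\<Sum>k<n. of_real (X $$ (i, k)) * of_real (X $$ (j, k)) * Delta x h k)"
    if "i < n" "j < n" for i j and h :: "'p \<Rightarrow> complex"
    using meet_closed_factorization[OF S_meet[unfolded S_def] ordered that, of h] that
    by (simp add: X_def if_distrib[of of_real] cong: if_cong)
  \<comment> \<open>The factorization applied to a vector. It serves for \<open>h = f\<close> with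
    \<open>v\<close>, and for \<open>h = g\<close> with \<open>v\<close> rescaled by the values
    \<open>f (x j)\<close>.\<close>
  have gather: "(\<Sum>j<n. h (inf (x i) (x j)) * z j)
      = (\<Sum>k<n. X $$ (i, k) * (Delta x h k * (\<Sum>j<n. X $$ (j, k) * z j)))"
    if i: "i < n" for i h and z :: "nat \<Rightarrow> complex"
  proof -
    have "(\<Sum>j<n. h (inf (x i) (x j)) * z j)
      = (\<Sum>j<n. \<Sum>k<n. of_real (X $$ (i, k)) * of_real (X $$ (j, k)) * Delta x h k * z j)"
      by (intro sum.cong refl) (simp only: sum_distrib_right[symmetric] lessThan_iff meet[OF i, of _ h])
    also have "\<dots> = (\<Sum>k<n. X $$ (i, k) * (Delta x h k * (\<Sum>j<n. X $$ (j, k) * z j)))"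
      unfolding sum_distrib_left by (subst sum.swap) (simp add: mult_ac)
    finally show ?thesis .
  qed
  have join: "f (sup a b) = f a * g (inf a b) * f b" for a b
    using f_semi f_nz[of "inf a b"] unfolding semimultiplicative_def g_def
    by (simp add: field_simps)
  have "(MIN i\<in>{..<n}. cmod (Delta x f i)) \<in> (\<lambda>i. cmod (Delta x f i)) ` {..<n}"
    using vnz by (intro Min_in) auto
  \<comment> \<open>The minimum is attained, hence is the modulus of some nonzero
    \<open>Delta x f i\<close>.\<close>
  then have MIN_pos: "0 < (MIN i\<in>{..<n}. cmod (Delta x f i))"
    using Delta_nz by auto
  show ?thesis
  proof (rule K_congruence_pencil_bound[OF X vnz, of _ "Delta x f" "Delta x g" _ "\<lambda>i. f (x i)"])
    fix i assume i: "i < n"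
    have "f (x i) * (\<Sum>j<n. g (inf (x i) (x j)) * (f (x j) * v $ j))
        = (\<Sum>j<n. f (sup (x i) (x j)) * v $ j)"
      by (simp add: join sum_distrib_left mult_ac)
    also have "\<dots> = (join_matrix n x f *\<^sub>v v) $ i"
      using i v by (simp add: join_matrix_def scalar_prod_def atLeast0LessThan)
    also have "\<dots> = lam * (\<Sum>j<n. f (inf (x i) (x j)) * v $ j)"
      unfolding eigen using i v by (simp add: meet_matrix_def scalar_prod_def atLeast0LessThan)
    finally show "f (x i) * (\<Sum>k<n. X $$ (i, k) * (Delta x g k * (\<Sum>j<n. X $$ (j, k) * (f (x j) * v $ j))))
      = lam * (\<Sum>k<n. X $$ (i, k) * (Delta x f k * (\<Sum>j<n. X $$ (j, k) * v $ j)))"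
      unfolding gather[OF i, of f "\<lambda>j. v $ j"] gather[OF i, of g "\<lambda>j. f (x j) * v $ j"] .
  qed (use MIN_pos in \<open>auto intro!: Min_le Max_ge\<close>)
qed

end
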